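(* Let $\mathcal{H}$ be a separable Hilbert space and let $W_1$ and $W_2$ be closed subspaces of $\mathcal{H}$ satisfying $\mathcal{H}=W_1\oplus W_2^\perp$. Let $\Phi=(\phi_n)_{n=1}^\infty$ be a frame for $W_2$ and let $\mathcal{P}(\Phi)$ denote the collection of all oblique dual frames of $\Phi$ on $W_1$. Then the following statements hold. (i) $\displaystyle\overline{\bigcup_{\Phi^{\mathrm{od}}\in\mathcal{P}(\Phi)}\operatorname{ran}(T^*_{\Phi^{\mathrm{od}}})}=\ell^2(\mathbb{N})$. (ii) Let $G=(g_n)_{n=1}^\infty$ be a frame for $W_2$. If every oblique dual frame of $\Phi$ on $W_1$ is also an oblique dual frame of $G$ on $W_1$, then $\Phi=G$.
   Context: $X\oplus Z$ denotes a direct sum, not necessarily orthogonal. A sequence $(x_n)_{n=1}^\infty$ in a closed subspace $X$ of $\mathcal{H}$ is a frame for $X$ if there are $A,B>0$ with $A\|h\|^2\le\sum_n|\langle h,x_n\rangle|^2\le B\|h\|^2$ for all $h\in X$. For such a sequence $F=(f_n)_{n=1}^\infty$ (which is then a Bessel sequence in $\mathcal{H}$, i.e. the upper inequality holds for all $h\in\mathcal{H}$), $T_F:\ell^2(\mathbb{N})\to\mathcal{H}$, $T_F(c_n)_{n=1}^\infty=\sum_n c_nf_n$, is the synthesis operator, with adjoint $T_F^*:\mathcal{H}\to\ell^2(\mathbb{N})$, $T_F^*h=(\langle h,f_n\rangle)_{n=1}^\infty$; $\operatorname{ran}$ denotes the range of an operator. If $\mathcal{H}=X\oplus Z$ with $X,Z$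 closed, $\pi_{X,Z}(x+z)=x$ ($x\in X,z\in Z$) is the oblique projection onto $X$ along $Z$. Given closed $W_1,W_2$ with $\mathcal{H}=W_1\oplus W_2^\perp$, a frame $F$ for $W_1$ is called an oblique dual frame, on $W_1$, of a frame $G$ for $W_2$ if $T_FT_G^*=\pi_{W_1,W_2^\perp}$.
   Formalization: Statement (i) is proved under the added hypothesis that W_1 is not {0}; when W_1 = {0}, then W_2 = {0}, Φ = 0 and the only oblique dual is zero, so the union of ranges is {0} and (i) fails. *)

theory Defs
  imports "HOL-Analysis.Analysis"
begin

section \<open>Hilbert spaces over the reals or the complex numbers\<close>

text \<open>
  HOL-Analysis provides real inner product spaces only. The scalar field is therefore a type of
  the following class, which has exactly two models up to isomorphism, the reals and the complex
  numbers with their usual conjugation: \<open>x + conjg x\<close> and \<open>x * conjg x\<close> are always real, so every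
  scalar is a root of a real quadratic polynomial.
\<close>

class real_or_complex = real_normed_field +
  fixes conjg :: "'a \<Rightarrow> 'a"
  assumes conjg_add: "conjg (x + y) = conjg x + conjg y"
    and conjg_mult: "conjg (x * y) = conjg x * conjg y"
    and mult_conjg_self: "x * conjg x = (norm x)\<^sup>2 *\<^sub>R 1"

instantiation real :: real_or_complex
begin

definition conjg_real :: "real \<Rightarrow> real" where "conjg_real x = x"

instance
  by standard (simp_all add: conjg_real_def power2_eq_square)

end

instantiation complex :: real_or_complex
begin

definition conjg_complex :: "complex \<Rightarrow> complex" where "conjg_complex = cnj"

instance
  by standard (simp_all add: conjg_complex_def complex_norm_square scaleR_conv_of_real del: of_real_power)

end

text \<open>
  Completeness is part of the class \<open>banach\<close>. The inner product is linear in its first argument.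
\<close>

locale hilbert_space = vector_space smul
  for smul :: "'k::real_or_complex \<Rightarrow> 'h::banach \<Rightarrow> 'h" +
  fixes ip :: "'h \<Rightarrow> 'h \<Rightarrow> 'k"
  assumes smul_of_real: "smul (of_real r) x = r *\<^sub>R x"
    and ip_add_left: "ip (x + y) z = ip x z + ip y z"
    and ip_smul_left: "ip (smul a x) y = a * ip x y"
    and ip_commute: "ip y x = conjg (ip x y)"
    and ip_self: "ip x x = of_real ((norm x)\<^sup>2)"

locale separable_hilbert_space = hilbert_space smul ip
  for smul :: "'k::real_or_complex \<Rightarrow> 'h::banach \<Rightarrow> 'h" and ip :: "'h \<Rightarrow> 'h \<Rightarrow> 'k" +
  assumes separable: "separable_space (euclidean :: 'h topology)"

lemma hilbert_space_real_inner:
  "hilbert_space scaleR (inner :: 'a::{real_inner,banach} \<Rightarrow> 'a \<Rightarrow> real)"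
  by unfold_locales
    (simp_all add: algebra_simps conjg_real_def inner_commute power2_norm_eq_inner)

lemma hilbert_space_complex:
  "hilbert_space (*) (\<lambda>x y::complex. x * cnj y)"
  by unfold_locales
    (simp_all add: algebra_simps conjg_complex_def complex_norm_square scaleR_conv_of_real
      del: of_real_power)

definition orth_compl :: "('h \<Rightarrow> 'h \<Rightarrow> 'k::zero) \<Rightarrow> 'h set \<Rightarrow> 'h set" where
  "orth_compl ip W = {h. \<forall>w\<in>W. ip h w = 0}"

definition is_direct_sum :: "'h::ab_group_add set \<Rightarrow> 'h set \<Rightarrow> bool" where
  "is_direct_sum X Z \<longleftrightarrow> {x + z | x z. x \<in> X \<and> z \<in> Z} = UNIV \<and> X \<inter> Z = {0}"

definition oblique_proj :: "'h::ab_group_add set \<Rightarrow> 'h set \<Rightarrow> 'h \<Rightarrow> 'h" where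
  "oblique_proj X Z h = (THE x. x \<in> X \<and> (\<exists>z\<in>Z. h = x + z))"


section \<open>The space of square-summable sequences\<close>

typedef (overloaded) 'k ell2 =
  "{c :: nat \<Rightarrow> 'k::real_normed_vector. summable (\<lambda>n. (norm (c n))\<^sup>2)}"
  morphisms ell2_nth Abs_ell2
  by (rule exI[of _ "\<lambda>_. 0"]) simp

setup_lifting type_definition_ell2

lemma ell2_add_aux:
  fixes c d :: "nat \<Rightarrow> 'k::real_normed_vector"
  assumes "summable (\<lambda>n. (norm (c n))\<^sup>2)" "summable (\<lambda>n. (norm (d n))\<^sup>2)"
  shows "summable (\<lambda>n. (norm (c n + d n))\<^sup>2)"
    and "sqrt (\<Sum>n. (norm (c n + d n))\<^sup>2)
          \<le> sqrt (\<Sum>n. (norm (c n))\<^sup>2) + sqrt (\<Sum>n. (norm (d n))\<^sup>2)"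
proof -
  let ?R = "sqrt (\<Sum>n. (norm (c n))\<^sup>2) + sqrt (\<Sum>n. (norm (d n))\<^sup>2)"
  have R: "?R \<ge> 0"
    by (simp add: assms suminf_nonneg)
  have part: "(\<Sum>n<N. (norm (c n + d n))\<^sup>2) \<le> ?R\<^sup>2" for N
  proof -
    have "L2_set (\<lambda>n. norm (c n + d n)) {..<N} \<le> L2_set (\<lambda>n. norm (c n) + norm (d n)) {..<N}"
      by (rule L2_set_mono) (auto intro: norm_triangle_ineq)
    also have "\<dots> \<le> L2_set (\<lambda>n. norm (c n)) {..<N} + L2_set (\<lambda>n. norm (d n)) {..<N}"
      by (rule L2_set_triangle_ineq)
    also have "\<dots> \<le> ?R"
      unfolding L2_set_def
      by (intro add_mono real_sqrt_le_mono sum_le_suminf assms) auto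
    finally have "sqrt (\<Sum>n<N. (norm (c n + d n))\<^sup>2) \<le> ?R"
      by (simp add: L2_set_def)
    then show ?thesis
      by (rule sqrt_le_D)
  qed
  show s: "summable (\<lambda>n. (norm (c n + d n))\<^sup>2)"
    by (rule bounded_imp_summable[of _ "?R\<^sup>2"])
      (use part[of "Suc _"] in \<open>auto simp: lessThan_Suc_atMost\<close>)
  have "(\<Sum>n. (norm (c n + d n))\<^sup>2) \<le> ?R\<^sup>2"
    by (rule suminf_le_const[OF s part])
  then show "sqrt (\<Sum>n. (norm (c n + d n))\<^sup>2) \<le> ?R"
    by (rule real_le_lsqrt[OF R])
qed

instantiation ell2 :: (real_normed_vector) real_normed_vector
begin

lift_definition zero_ell2 :: "'a ell2" is "\<lambda>_. 0" by simp

lift_definition plus_ell2 :: "'a ell2 \<Rightarrow> 'a ell2 \<Rightarrow> 'a ell2" is "\<lambda>c d n. c n + d n"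
  by (rule ell2_add_aux)

lift_definition uminus_ell2 :: "'a ell2 \<Rightarrow> 'a ell2" is "\<lambda>c n. - c n" by simp

lift_definition minus_ell2 :: "'a ell2 \<Rightarrow> 'a ell2 \<Rightarrow> 'a ell2" is "\<lambda>c d n. c n - d n"
  using ell2_add_aux(1)[of _ "\<lambda>n. - _ n"] by simp

lift_definition scaleR_ell2 :: "real \<Rightarrow> 'a ell2 \<Rightarrow> 'a ell2" is "\<lambda>r c n. r *\<^sub>R c n"
  by (simp add: power_mult_distrib summable_mult)

lift_definition norm_ell2 :: "'a ell2 \<Rightarrow> real" is "\<lambda>c. sqrt (\<Sum>n. (norm (c n))\<^sup>2)" .

definition dist_ell2 :: "'a ell2 \<Rightarrow> 'a ell2 \<Rightarrow> real" where
  "dist_ell2 c d = norm (c - d)"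

definition sgn_ell2 :: "'a ell2 \<Rightarrow> 'a ell2" where
  "sgn_ell2 c = inverse (norm c) *\<^sub>R c"

definition uniformity_ell2 :: "('a ell2 \<times> 'a ell2) filter" where
  "uniformity_ell2 = (INF e\<in>{0<..}. principal {(c, d). dist c d < e})"

definition open_ell2 :: "'a ell2 set \<Rightarrow> bool" where
  "open_ell2 U \<longleftrightarrow> (\<forall>c\<in>U. eventually (\<lambda>(c', d). c' = c \<longrightarrow> d \<in> U) uniformity)"

instance
proof
  fix c d e :: "'a ell2" and r s :: real and U :: "'a ell2 set"
  show "c + d + e = c + (d + e)" by transfer (simp add: add.assoc)
  show "c + d = d + c" by transfer (simp add: add.commute)
  show "0 + c = c" by transfer simp
  show "- c + c = 0" by transfer simp
  show "c - d = c + - d" by transfer simp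
  show "r *\<^sub>R (c + d) = r *\<^sub>R c + r *\<^sub>R d" by transfer (simp add: scaleR_add_right)
  show "(r + s) *\<^sub>R c = r *\<^sub>R c + s *\<^sub>R c" by transfer (simp add: scaleR_add_left)
  show "r *\<^sub>R s *\<^sub>R c = (r * s) *\<^sub>R c" by transfer simp
  show "1 *\<^sub>R c = c" by transfer simp
  show "dist c d = norm (c - d)" by (rule dist_ell2_def)
  show "sgn c = inverse (norm c) *\<^sub>R c" by (rule sgn_ell2_def)
  show "uniformity = (INF e\<in>{0<..}. principal {(c, d::'a ell2). dist c d < e})"
    by (rule uniformity_ell2_def)
  show "open U \<longleftrightarrow> (\<forall>c\<in>U. \<forall>\<^sub>F (c', d) in uniformity. c' = c \<longrightarrow> d \<in> U)"
    by (rule open_ell2_def)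
  show "norm c = 0 \<longleftrightarrow> c = 0"
    by transfer (auto simp: suminf_eq_zero_iff)
  show "norm (c + d) \<le> norm c + norm d"
    by transfer (rule ell2_add_aux)
  show "norm (r *\<^sub>R c) = \<bar>r\<bar> * norm c"
    by transfer (simp add: power_mult_distrib suminf_mult real_sqrt_mult)
qed

end


section \<open>Frames and oblique dual frames\<close>

text \<open>
  Sequences are indexed from 0. Convergence of the series is part of the upper frame inequality.
\<close>

definition is_frame ::
  "('h::real_normed_vector \<Rightarrow> 'h \<Rightarrow> 'k::real_normed_vector) \<Rightarrow> 'h set \<Rightarrow> (nat \<Rightarrow> 'h) \<Rightarrow> bool" where
  "is_frame ip X f \<longleftrightarrow>
    range f \<subseteq> X \<and>
    (\<exists>A>0. \<exists>B>0. \<forall>h\<in>X.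
      summable (\<lambda>n. (norm (ip h (f n)))\<^sup>2) \<and>
      A * (norm h)\<^sup>2 \<le> (\<Sum>n. (norm (ip h (f n)))\<^sup>2) \<and>
      (\<Sum>n. (norm (ip h (f n)))\<^sup>2) \<le> B * (norm h)\<^sup>2)"

text \<open>The next two operators are meaningful for Bessel sequences only.\<close>

definition synthesis ::
  "('k::real_normed_vector \<Rightarrow> 'h::real_normed_vector \<Rightarrow> 'h) \<Rightarrow> (nat \<Rightarrow> 'h) \<Rightarrow> 'k ell2 \<Rightarrow> 'h" where
  "synthesis smul f c = (\<Sum>n. smul (ell2_nth c n) (f n))"

definition analysis ::
  "('h \<Rightarrow> 'h \<Rightarrow> 'k::real_normed_vector) \<Rightarrow> (nat \<Rightarrow> 'h) \<Rightarrow> 'h \<Rightarrow> 'k ell2" where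
  "analysis ip f h = Abs_ell2 (\<lambda>n. ip h (f n))"

definition oblique_duals ::
  "('k::real_or_complex \<Rightarrow> 'h::banach \<Rightarrow> 'h) \<Rightarrow> ('h \<Rightarrow> 'h \<Rightarrow> 'k) \<Rightarrow>
    'h set \<Rightarrow> 'h set \<Rightarrow> (nat \<Rightarrow> 'h) \<Rightarrow> (nat \<Rightarrow> 'h) set" where
  "oblique_duals smul ip W1 W2 g =
    {f. is_frame ip W1 f \<and>
        synthesis smul f \<circ> analysis ip g = oblique_proj W1 (orth_compl ip W2)}"

end

theory Submission
  imports Defs
begin

text \<open>
  Let \<open>T\<close> be the analysis operator of \<open>\<Phi>\<close>, \<open>\<pi>\<close> the oblique projection onto \<open>W1\<close> and \<open>R\<close> the left inverse
  of \<open>T\<close> on \<open>W2\<close> that vanishes on the orthogonal complement of the range of \<open>T\<close>. Oblique duals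
  correspond to bounded operators \<open>M\<close> from the sequence space to \<open>W1\<close> with \<open>M T = \<pi>\<close>, through the
  images of the unit vectors. The operators \<open>c \<mapsto> \<pi> (R c) + \<langle>c, m\<rangle> u\<close>, with \<open>m\<close> orthogonal to the
  range of \<open>T\<close> and \<open>u \<in> W1\<close>, are of this kind. Given \<open>c\<close> with \<open>R c \<noteq> 0\<close>, the choice
  \<open>m = c - T (R c)\<close> and a suitable \<open>u\<close> put \<open>c\<close> into the range of the analysis operator of the
  dual; such \<open>c\<close> are dense. For (ii), the same rank one perturbations force the range of the analysis
  operator of \<open>G\<close> into the range of \<open>T\<close>, and then \<open>\<pi> R\<close> identifies the two operators.
\<close>

section \<open>The scalar field\<close>

text \<open>Polarisation: |1 + x|^2 = 1 + 2 Re x + |x|^2 expresses the real part through the norm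
  alone, independently of the model of the class.\<close>

definition re :: "'k::real_or_complex \<Rightarrow> real" where
  "re x = ((norm (1 + x))\<^sup>2 - 1 - (norm x)\<^sup>2) / 2"

lemma conjg_0 [simp]: "conjg 0 = (0 :: 'k::real_or_complex)"
  using conjg_add[of 0 "0 :: 'k"] by simp

lemma conjg_1 [simp]: "conjg 1 = (1 :: 'k::real_or_complex)"
  using mult_conjg_self[of "1 :: 'k"] by simp

lemma mult_conjg: "x * conjg x = (of_real ((norm x)\<^sup>2) :: 'k::real_or_complex)"
  by (simp add: mult_conjg_self of_real_def)

text \<open>Take norms in \<open>x * conjg x = |x|^2\<close> and cancel \<open>norm x\<close>.
  Cancellation in the same identity yields \<open>conjg_conjg\<close> and
  \<open>conjg_of_real\<close>.\<close>

lemma norm_conjg [simp]: "norm (conjg x) = norm (x :: 'k::real_or_complex)"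
proof (cases "x = 0")
  case False
  have "norm x * norm (conjg x) = norm x * norm x"
    using arg_cong[OF mult_conjg[of x], of norm] by (simp add: norm_mult power2_eq_square)
  with False show ?thesis by simp
qed simp

lemma conjg_conjg [simp]: "conjg (conjg x) = (x :: 'k::real_or_complex)"
proof (cases "x = 0")
  case False
  then have "conjg x \<noteq> 0"
    by (metis norm_conjg norm_eq_zero)
  moreover have "conjg x * conjg (conjg x) = conjg x * x"
    using mult_conjg[of x] mult_conjg[of "conjg x"] by (simp add: mult.commute)
  ultimately show ?thesis by simp
qed simp

lemma conjg_minus: "conjg (- x) = - conjg (x :: 'k::real_or_complex)"
  using conjg_add[of x "- x"] by (simp add: eq_neg_iff_add_eq_0 add.commute)

lemma conjg_diff: "conjg (x - y) = conjg x - conjg (y :: 'k::real_or_complex)"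
  using conjg_add[of x "- y"] by (simp add: conjg_minus)

lemma conjg_of_real [simp]: "conjg (of_real r) = (of_real r :: 'k::real_or_complex)"
proof (cases "r = 0")
  case False
  have "of_real r * conjg (of_real r :: 'k) = of_real r * of_real r"
    by (simp add: mult_conjg power2_eq_square)
  with False show ?thesis by simp
qed simp

lemma add_conjg: "x + conjg x = (of_real (2 * re x) :: 'k::real_or_complex)"
proof -
  have "(1 + x) * conjg (1 + x) = 1 + (x + conjg x) + x * conjg x"
    by (simp add: conjg_add algebra_simps)
  then have "x + conjg x = of_real ((norm (1 + x))\<^sup>2) - 1 - of_real ((norm x)\<^sup>2)"
    unfolding mult_conjg by (simp add: algebra_simps)
  then show ?thesis by (simp add: re_def)
qed

lemma re_add: "re (x + y) = re x + re (y :: 'k::real_or_complex)"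
proof -
  have "(of_real (2 * re (x + y)) :: 'k) = of_real (2 * re x + 2 * re y)"
    unfolding of_real_add add_conjg[symmetric] by (simp add: conjg_add)
  then show ?thesis
    by (simp only: of_real_eq_iff)
qed

lemma re_scaleR: "re (r *\<^sub>R x) = r * re (x :: 'k::real_or_complex)"
proof -
  have "(of_real (2 * re (r *\<^sub>R x)) :: 'k) = of_real (r * (2 * re x))"
    unfolding of_real_mult[of r] add_conjg[symmetric]
    by (simp add: conjg_mult scaleR_conv_of_real algebra_simps)
  then show ?thesis
    by (simp only: of_real_eq_iff)
qed

lemma re_conjg [simp]: "re (conjg x) = re (x :: 'k::real_or_complex)"
  by (metis (no_types) add.commute add_conjg conjg_conjg of_real_eq_iff mult_cancel_left zero_neq_numeral)

lemma re_of_real [simp]: "re (of_real r :: 'k::real_or_complex) = r"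
  using add_conjg[of "of_real r :: 'k"]
  by (metis conjg_of_real mult_2 mult_cancel_left of_real_add of_real_eq_iff zero_neq_numeral)

lemma abs_re_le: "\<bar>re x\<bar> \<le> norm (x :: 'k::real_or_complex)"
proof -
  have "norm (x + conjg x) \<le> norm x + norm x"
    by (metis norm_conjg norm_triangle_ineq)
  then show ?thesis
    by (simp add: add_conjg del: of_real_mult)
qed

lemma bounded_linear_re: "bounded_linear (re :: 'k::real_or_complex \<Rightarrow> real)"
  by (rule bounded_linear_intro[where K = 1]) (auto simp: re_add re_scaleR abs_re_le)

lemma of_real_re: "conjg x = x \<Longrightarrow> of_real (re x) = (x :: 'k::real_or_complex)"
  using add_conjg[of x] by simp

lemma bounded_linear_conjg: "bounded_linear (conjg :: 'k::real_or_complex \<Rightarrow> 'k)"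
  by (rule bounded_linear_intro[where K = 1])
    (auto simp: conjg_add conjg_mult scaleR_conv_of_real)

text \<open>
  The class does not assume completeness. If conjugation is not trivial, then
  \<open>j = i - conjg i\<close> is purely imaginary, and multiplication by \<open>j\<close> makes imaginary parts real.
\<close>

lemma summable_norm_cancel_real_or_complex:
  fixes f :: "nat \<Rightarrow> 'k::real_or_complex"
  assumes "summable (\<lambda>n. norm (f n))"
  shows "summable f"
proof -
  \<comment> \<open>Completeness of the reals enters here, through the real parts of any sequence
    dominated by a multiple of \<open>norm (f n)\<close>.\<close>
  have real: "summable (\<lambda>n. of_real (re (g n)) :: 'k)"
    if "\<And>n. norm (g n) \<le> C * norm (f n)" for g :: "nat \<Rightarrow> 'k" and C
  proof -
    have "summable (\<lambda>n. re (g n))"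
      by (rule summable_comparison_test'[OF summable_mult[OF assms, of C]])
        (use abs_re_le that order_trans in \<open>fastforce\<close>)
    then show ?thesis
      by (rule bounded_linear.summable[OF bounded_linear_of_real])
  qed
  show ?thesis
  proof (cases "\<forall>x::'k. conjg x = x")
    case True
    then show ?thesis
      using real[of f 1] by (simp add: of_real_re)
  next
    case False
    then obtain i :: 'k where i: "conjg i \<noteq> i" by blast
    define j where "j = i - conjg i"
    have j: "j \<noteq> 0" "conjg j = - j"
      using i by (auto simp: j_def conjg_diff)
    let ?g = "\<lambda>n. (f n - conjg (f n)) * j"
    have g: "of_real (re (?g n)) = ?g n" for n
      by (rule of_real_re) (simp add: conjg_mult conjg_diff j algebra_simps)
    have "norm (?g n) \<le> (2 * norm j) * norm (f n)" for n
      unfolding norm_mult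
      using mult_right_mono[OF norm_triangle_ineq4[of "f n" "conjg (f n)"], of "norm j"]
      by (simp add: ac_simps)
    from real[OF this] have "summable ?g"
      by (simp only: g)
    from summable_mult[OF this, of "inverse (2 * j)"]
    have "summable (\<lambda>n. of_real (re (f n)) + inverse (2 * j) * ?g n)"
      by (rule summable_add[OF real[of f 1, simplified]])
    moreover have "of_real (re (f n)) + inverse (2 * j) * ?g n = f n" for n
    proof -
      have "of_real (re (f n)) = (f n + conjg (f n)) / 2"
        by (simp add: add_conjg)
      then show ?thesis
        using j(1) by (simp add: field_simps)
    qed
    ultimately show ?thesis by simp
  qed
qed

section \<open>Inner products\<close>

text \<open>The laws of \<open>hilbert_space\<close> over an arbitrary normed space, so that one set
  of lemmas serves both \<open>'h\<close> and \<open>'k ell2\<close>.\<close>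

locale inner_space = vector_space smul
  for smul :: "'k::real_or_complex \<Rightarrow> 'v::real_normed_vector \<Rightarrow> 'v" +
  fixes ip :: "'v \<Rightarrow> 'v \<Rightarrow> 'k"
  assumes smul_of_real: "smul (of_real r) x = r *\<^sub>R x"
    and ip_add_left: "ip (x + y) z = ip x z + ip y z"
    and ip_smul_left: "ip (smul a x) y = a * ip x y"
    and ip_commute: "ip y x = conjg (ip x y)"
    and ip_self: "ip x x = of_real ((norm x)\<^sup>2)"
begin

lemma ip_add_right: "ip x (y + z) = ip x y + ip x z"
  by (metis conjg_add ip_add_left ip_commute)

lemma ip_smul_right: "ip x (smul a y) = conjg a * ip x y"
  by (metis conjg_mult ip_commute ip_smul_left)

lemma ip_scaleR_left: "ip (r *\<^sub>R x) y = r *\<^sub>R ip x y"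
  by (simp add: smul_of_real[symmetric] ip_smul_left scaleR_conv_of_real)

lemma ip_scaleR_right: "ip x (r *\<^sub>R y) = r *\<^sub>R ip x y"
  by (simp add: smul_of_real[symmetric] ip_smul_right scaleR_conv_of_real)

lemma ip_0_left [simp]: "ip 0 y = 0"
  using ip_scaleR_left[of 0] by simp

lemma ip_0_right [simp]: "ip x 0 = 0"
  using ip_scaleR_right[of _ 0] by simp

lemma ip_minus_left: "ip (- x) y = - ip x y"
  using ip_scaleR_left[of "- 1"] by simp

lemma ip_minus_right: "ip x (- y) = - ip x y"
  using ip_scaleR_right[of _ "- 1"] by simp

lemma ip_diff_left: "ip (x - y) z = ip x z - ip y z"
  using ip_add_left[of x "- y"] by (simp add: ip_minus_left)

lemma ip_diff_right: "ip x (y - z) = ip x y - ip x z"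
  using ip_add_right[of x y "- z"] by (simp add: ip_minus_right)

lemma ip_self_eq_0_iff [simp]: "ip x x = 0 \<longleftrightarrow> x = 0"
  by (simp add: ip_self)

lemma ip_eq_0_commute: "ip x y = 0 \<longleftrightarrow> ip y x = 0"
  by (metis conjg_0 ip_commute)

lemma norm_smul: "norm (smul a x) = norm a * norm x"
proof -
  have "ip (smul a x) (smul a x) = (a * conjg a) * ip x x"
    by (simp add: ip_smul_left ip_smul_right)
  then have "(of_real ((norm (smul a x))\<^sup>2) :: 'k) = of_real ((norm a * norm x)\<^sup>2)"
    by (simp only: ip_self mult_conjg power_mult_distrib of_real_mult)
  then show ?thesis
    by (simp only: of_real_eq_iff power2_eq_iff_nonneg norm_ge_zero mult_nonneg_nonneg)
qed

lemma Cauchy_Schwarz: "norm (ip x y) \<le> norm x * norm y"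
proof (cases "y = 0")
  case False
  \<comment> \<open>\<open>|y|^2\<close> times the component of \<open>x\<close> orthogonal to
    \<open>y\<close>; this scaling avoids a division.\<close>
  define z where "z = smul (of_real ((norm y)\<^sup>2)) x - smul (ip x y) y"
  have "ip z y = 0"
    by (simp add: z_def ip_diff_left ip_smul_left ip_self mult.commute)
  then have "ip z z = conjg (of_real ((norm y)\<^sup>2)) * ip z x"
    by (subst (2) z_def) (simp add: ip_diff_right ip_smul_right)
  also have "\<dots> = of_real ((norm y)\<^sup>2) * (of_real ((norm y)\<^sup>2) * ip x x - ip x y * conjg (ip x y))"
    unfolding conjg_of_real by (simp add: z_def ip_diff_left ip_smul_left flip: ip_commute[of y x])
  also have "\<dots> = of_real ((norm y)\<^sup>2 * ((norm y)\<^sup>2 * (norm x)\<^sup>2 - (norm (ip x y))\<^sup>2))"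
    by (simp add: mult_conjg ip_self)
  finally have "(norm z)\<^sup>2 = (norm y)\<^sup>2 * ((norm y)\<^sup>2 * (norm x)\<^sup>2 - (norm (ip x y))\<^sup>2)"
    by (simp only: ip_self of_real_eq_iff)
  then have "0 \<le> (norm y)\<^sup>2 * ((norm y)\<^sup>2 * (norm x)\<^sup>2 - (norm (ip x y))\<^sup>2)"
    by (metis zero_le_power2)
  with False have "(norm (ip x y))\<^sup>2 \<le> (norm x * norm y)\<^sup>2"
    by (simp add: zero_le_mult_iff power_mult_distrib mult.commute)
  then show ?thesis
    by (rule power2_le_imp_le) simp
qed simp

lemma bounded_bilinear_ip: "bounded_bilinear ip"
  by unfold_locales
    (auto simp: ip_add_left ip_add_right ip_scaleR_left ip_scaleR_right
      intro!: exI[of _ 1] Cauchy_Schwarz)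

lemma subspace_real: "subspace W \<Longrightarrow> Real_Vector_Spaces.subspace W"
  by (metis Real_Vector_Spaces.subspace_def smul_of_real subspace_def)

end

sublocale hilbert_space \<subseteq> inner_space
  by unfold_locales (fact smul_of_real ip_add_left ip_smul_left ip_commute ip_self)+

section \<open>Bounded projections and the Riesz representation\<close>

text \<open>Completeness of the type in the form that the Baire theorem asks for.\<close>

lemma complete_space_euclidean: "Met_TC.mcomplete TYPE('a::complete_space)"
  unfolding Met_TC.mcomplete_def
  by (metis Cauchy_convergent_iff Met_TC.MCauchy_def convergent_def metric_CauchyI limitin_iff_tendsto)

text \<open>
  The bounded inverse theorem for the addition map \<open>X \<times> Z \<rightarrow> H\<close>: by Baire, vectors \<open>x + z\<close> with
  \<open>\<parallel>x\<parallel>, \<parallel>z\<parallel> \<le> n\<close> are dense in some ball, and successive approximation removes the closure.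
\<close>

lemma direct_sum_projection_bounded:
  fixes X Z :: "'a::banach set"
  assumes X: "subspace X" "closed X" and Z: "subspace Z" "closed Z"
    and XZ: "X \<inter> Z = {0}" and sum: "\<And>h. \<exists>x\<in>X. \<exists>z\<in>Z. h = x + z"
  obtains C where "C > 0" "\<And>x z. x \<in> X \<Longrightarrow> z \<in> Z \<Longrightarrow> norm x \<le> C * norm (x + z)"
proof -
  define E where "E n = {x + z | x z. x \<in> X \<and> z \<in> Z \<and> norm x \<le> real n \<and> norm z \<le> real n}" for n
  have "\<exists>n. interior (closure (E n)) \<noteq> {}"
  proof (rule ccontr)
    assume "\<not> ?thesis"
    then have "Met_TC.mtopology interior_of (\<Union>n. closure (E n)) = ({} :: 'a set)"
      by (intro Met_TC.metric_Baire_category_alt complete_space_euclidean) auto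
    moreover have "(\<Union>n. closure (E n)) = UNIV"
    proof (intro set_eqI iffI UNIV_I)
      fix h :: 'a
      obtain x z where h: "x \<in> X" "z \<in> Z" "h = x + z" using sum by blast
      obtain n :: nat where "max (norm x) (norm z) \<le> real n" using real_arch_simple by blast
      with h have "h \<in> E n" by (auto simp: E_def)
      then show "h \<in> (\<Union>n. closure (E n))" using closure_subset by blast
    qed
    ultimately show False by simp
  qed
  then obtain n h0 r where r: "r > 0" and ball: "ball h0 r \<subseteq> closure (E n)"
    by (metis ex_in_conv interior_subset mem_interior)
  \<comment> \<open>The dense ball is moved to the origin: \<open>h\<close> is half the difference
    of \<open>h0 + h\<close> and \<open>h0 - h\<close>, and halving a difference keeps the
    components of norm at most \<open>n\<close>.\<close>
  have small: "\<exists>x\<in>X. \<exists>z\<in>Z. norm x \<le> n \<and> norm z \<le> n \<and> norm (h - x - z) < e"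
    if h: "norm h < r" and e: "e > 0" for h e
  proof -
    have "h0 + h \<in> closure (E n)" "h0 - h \<in> closure (E n)"
      using ball h by (auto simp: subset_iff dist_norm)
    with e obtain a b where a: "a \<in> E n" "dist a (h0 + h) < e"
      and b: "b \<in> E n" "dist b (h0 - h) < e"
      unfolding closure_approachable by blast
    obtain x z where x: "a = x + z" "x \<in> X" "z \<in> Z" "norm x \<le> n" "norm z \<le> n"
      using a(1) by (auto simp: E_def)
    obtain x' z' where x': "b = x' + z'" "x' \<in> X" "z' \<in> Z" "norm x' \<le> n" "norm z' \<le> n"
      using b(1) by (auto simp: E_def)
    have half: "norm ((1/2) *\<^sub>R (u - v)) \<le> n" if "norm u \<le> n" "norm v \<le> n" for u v :: 'a
      using norm_triangle_ineq4[of u v] that by simp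
    have "h - (1/2) *\<^sub>R (x - x') - (1/2) *\<^sub>R (z - z') = (1/2) *\<^sub>R (((h0 + h) - a) - ((h0 - h) - b))"
      by (simp add: x x' algebra_simps flip: scaleR_left.add)
    also have "norm \<dots> < e"
      using a(2) b(2) norm_triangle_ineq4[of "(h0 + h) - a" "(h0 - h) - b"]
      by (simp add: dist_norm norm_minus_commute)
    finally show ?thesis
      using x x' half X(1) Z(1) by (meson subspace_diff subspace_scale)
  qed
  \<comment> \<open>A nonzero \<open>h\<close> is rescaled to norm \<open>r / 2\<close>, inside the
    ball. Undoing this multiplies the bound \<open>n\<close> on the components by
    \<open>2 * norm h / r\<close>.\<close>
  define K where "K = 2 * n / r"
  have K: "K \<ge> 0" using r by (simp add: K_def)
  have approx: "\<exists>p. fst p \<in> X \<and> snd p \<in> Z \<and> norm (fst p) \<le> K * norm h \<and> norm (snd p) \<le> K * norm h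
      \<and> norm (h - fst p - snd p) < e" if e: "e > 0" for h e
  proof (cases "h = 0")
    case True
    then show ?thesis using e X Z by (intro exI[of _ "(0, 0)"]) (simp add: subspace_0)
  next
    case False
    define t where "t = r / (2 * norm h)"
    have t: "t > 0" "K * norm h = n / t" using False r by (auto simp: t_def K_def)
    have "norm (t *\<^sub>R h) < r" using False r by (simp add: t_def)
    from small[OF this, of "t * e"] t e obtain x z
      where x: "x \<in> X" "z \<in> Z" "norm x \<le> n" "norm z \<le> n" and d: "norm (t *\<^sub>R h - x - z) < t * e"
      by auto
    have "h - x /\<^sub>R t - z /\<^sub>R t = (t *\<^sub>R h - x - z) /\<^sub>R t"
      using t by (simp add: algebra_simps)
    also have "norm \<dots> = norm (t *\<^sub>R h - x - z) / t"
      using t by (simp add: divide_inverse mult.commute)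
    also have "\<dots> < e"
      using d t by (simp add: pos_divide_less_eq mult.commute)
    finally have "norm (h - x /\<^sub>R t - z /\<^sub>R t) < e" .
    then show ?thesis
      using x t X Z
      by (intro exI[of _ "(x /\<^sub>R t, z /\<^sub>R t)"]) (auto simp: subspace_scale field_simps)
  qed
  define good where "good h e p \<longleftrightarrow> fst p \<in> X \<and> snd p \<in> Z \<and> norm (fst p) \<le> K * norm h
      \<and> norm (snd p) \<le> K * norm h \<and> norm (h - fst p - snd p) < e" for h e p
  have "\<forall>h e. \<exists>p. e > 0 \<longrightarrow> good h e p"
    unfolding good_def using approx by blast
  then obtain p' where "\<forall>h e. e > 0 \<longrightarrow> good h e (p' h e)"
    unfolding choice_iff by blast
  then obtain p where p: "\<And>h e. e > 0 \<Longrightarrow> fst (p h e) \<in> X \<and> snd (p h e) \<in> Z \<and>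
      norm (fst (p h e)) \<le> K * norm h \<and> norm (snd (p h e)) \<le> K * norm h
      \<and> norm (h - fst (p h e) - snd (p h e)) < e"
    unfolding good_def by blast
  have main: "\<exists>x\<in>X. \<exists>z\<in>Z. h = x + z \<and> norm x \<le> 2 * K * norm h" if "h \<noteq> 0" for h
  proof -
    \<comment> \<open>The tolerances halve, so the residuals are at most
      \<open>norm h / 2 ^ k\<close>, the k-th corrections at most \<open>K * norm h / 2 ^ k\<close>,
      and these bounds sum to \<open>2 * K * norm h\<close>.\<close>
    define e where "e k = norm h / 2 ^ Suc k" for k
    define res where "res = rec_nat h (\<lambda>k u. u - fst (p u (e k)) - snd (p u (e k)))"
    have e: "e k > 0" for k using that by (simp add: e_def)
    define x where "x k = fst (p (res k) (e k))" for k
    define z where "z k = snd (p (res k) (e k))" for k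
    have res_Suc: "res (Suc k) = res k - x k - z k" for k
      by (simp add: res_def x_def z_def)
    have res: "norm (res k) \<le> norm h * (1/2) ^ k" for k
    proof (cases k)
      case (Suc j)
      then show ?thesis
        using p[OF e[of j], of "res j"] unfolding x_def[symmetric] z_def[symmetric] res_Suc[symmetric]
        by (simp add: e_def power_one_over field_simps)
    qed (simp add: res_def)
    have mem: "x k \<in> X" "z k \<in> Z" for k
      using p[OF e] by (auto simp: x_def z_def)
    have "norm (x k) \<le> K * norm (res k)" "norm (z k) \<le> K * norm (res k)" for k
      using p[OF e] by (auto simp: x_def z_def)
    then have bd: "norm (x k) \<le> K * norm h * (1/2) ^ k" "norm (z k) \<le> K * norm h * (1/2) ^ k" for k
      using mult_left_mono[OF res K, of k] by (auto intro: order_trans simp: mult.assoc)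
    have geo: "(\<lambda>k. K * norm h * (1/2) ^ k) sums (K * norm h * 2)"
      using sums_mult[OF geometric_sums[of "1/2 :: real"], of "K * norm h"] by simp
    have sx: "summable (\<lambda>k. norm (x k))" and sz: "summable (\<lambda>k. norm (z k))"
      by (rule summable_comparison_test'[OF sums_summable[OF geo]]; simp add: bd)+
    have "x sums suminf x" "z sums suminf z"
      using sx sz summable_norm_cancel summable_sums by blast+
    then have lim: "(\<lambda>n. \<Sum>k<n. x k) \<longlonglongrightarrow> suminf x" "(\<lambda>n. \<Sum>k<n. z k) \<longlonglongrightarrow> suminf z"
      by (auto simp: sums_def)
    have "suminf x \<in> X" "suminf z \<in> Z"
      by (rule closed_sequentially[OF X(2) _ lim(1)] closed_sequentially[OF Z(2) _ lim(2)],
          intro subspace_sum X Z mem)+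
    moreover have "h = suminf x + suminf z"
    proof -
      have part: "(\<Sum>k<n. x k) + (\<Sum>k<n. z k) = h - res n" for n
        by (induction n) (auto simp: res_Suc res_def[THEN fun_cong, of 0] algebra_simps)
      have "res \<longlonglongrightarrow> 0"
      proof (rule Lim_null_comparison)
        show "(\<lambda>k. norm h * (1/2) ^ k) \<longlonglongrightarrow> 0"
          by (intro tendsto_mult_right_zero LIMSEQ_power_zero) simp
      qed (simp add: res)
      then have "(\<lambda>n. h - res n) \<longlonglongrightarrow> h - 0" by (intro tendsto_intros)
      moreover have "(\<lambda>n. h - res n) \<longlonglongrightarrow> suminf x + suminf z"
        unfolding part[symmetric] by (intro tendsto_add lim)
      ultimately show ?thesis using LIMSEQ_unique by fastforce
    qed
    moreover have "norm (suminf x) \<le> 2 * K * norm h"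
      using summable_norm[OF sx] suminf_le[OF bd(1) sx sums_summable[OF geo]] sums_unique[OF geo]
      by (simp add: algebra_simps)
    ultimately show ?thesis by blast
  qed
  show ?thesis
  proof
    \<comment> \<open>The summand 1 keeps the constant positive when \<open>K = 0\<close>.\<close>
    show "2 * K + 1 > 0" using K by simp
    fix x z assume xz: "x \<in> X" "z \<in> Z"
    show "norm x \<le> (2 * K + 1) * norm (x + z)"
    proof (cases "x + z = 0")
      case True
      then have "x = - z" by (simp add: eq_neg_iff_add_eq_0)
      then have "x \<in> X \<inter> Z" using xz Z by (simp add: subspace_neg)
      with XZ K show ?thesis by simp
    next
      case False
      from main[OF this] obtain x' z' where x': "x' \<in> X" "z' \<in> Z" "x + z = x' + z'"
        "norm x' \<le> 2 * K * norm (x + z)" by blast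
      have "x - x' = z' - z" using x'(3) by (simp add: algebra_simps)
      then have "x - x' \<in> X \<inter> Z"
        using xz x' X Z by (metis IntI subspace_diff)
      then have "x = x'" using XZ by simp
      then show ?thesis using x'(4) by (simp add: distrib_right add_increasing2)
    qed
  qed
qed

text \<open>The representing vector minimises \<open>J x = B x x - 2 * f x\<close> over
  \<open>W\<close>: coercivity makes a minimising sequence Cauchy, and the first variation of
  \<open>J\<close> at the limit vanishes.\<close>

lemma riesz_symmetric_form:
  fixes B :: "'a::banach \<Rightarrow> 'a \<Rightarrow> real"
  assumes W: "subspace W" "closed W"
    and B: "bounded_bilinear B" and sym: "\<And>x y. B x y = B y x"
    and a: "a > 0" and coer: "\<And>x. x \<in> W \<Longrightarrow> a * (norm x)\<^sup>2 \<le> B x x"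
    and f: "bounded_linear f"
  obtains x where "x \<in> W" "\<And>y. y \<in> W \<Longrightarrow> B y x = f y"
proof -
  interpret B: bounded_bilinear B by fact
  interpret f: bounded_linear f by fact
  obtain K where K: "\<And>x. norm (f x) \<le> norm x * K" using f.bounded by blast
  define J where "J x = B x x - 2 * f x" for x
  define m where "m = Inf (J ` W)"
  have J_ge: "- (K\<^sup>2 / a) \<le> J x" if "x \<in> W" for x
  proof -
    \<comment> \<open>Completing the square in \<open>norm x\<close> bounds \<open>J\<close>
      below.\<close>
    have "0 \<le> (a * norm x - K)\<^sup>2 / a" using a by simp
    also have "\<dots> = a * (norm x)\<^sup>2 - 2 * (norm x * K) + K\<^sup>2 / a"
      using a by (simp add: power2_diff field_simps power2_eq_square)
    finally show ?thesis
      using coer[OF that] K[of x] by (simp add: J_def)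
  qed
  have bdd: "bdd_below (J ` W)" by (rule bdd_belowI2[OF J_ge])
  have m_le: "m \<le> J x" if "x \<in> W" for x
    unfolding m_def by (rule cInf_lower[OF _ bdd]) (use that in simp)
  have ex: "\<exists>x\<in>W. J x < m + e" if "e > 0" for e
    using cInf_lessD[of "J ` W" "m + e"] that subspace_0[OF W(1)] by (auto simp: m_def)
  have parallelogram: "a / 2 * (norm (x - y))\<^sup>2 \<le> J x + J y - 2 * m" if xy: "x \<in> W" "y \<in> W" for x y
  proof -
    have "m \<le> J ((1/2) *\<^sub>R (x + y))"
      using xy W by (intro m_le subspace_scale subspace_add)
    \<comment> \<open>The parallelogram law for \<open>B\<close>; the linear terms cancel.\<close>
    moreover have "J x + J y - 2 * J ((1/2) *\<^sub>R (x + y)) = B (x - y) (x - y) / 2"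
      by (simp add: J_def B.add_left B.add_right B.diff_left B.diff_right B.scaleR_left B.scaleR_right
          f.scaleR f.add sym[of y x] field_simps)
    ultimately show ?thesis
      using coer[of "x - y"] xy W by (simp add: subspace_diff)
  qed
  obtain u where u: "\<And>n. u n \<in> W \<and> J (u n) < m + inverse (real (Suc n))"
    using ex[of "inverse (real (Suc _))"] by (metis inverse_positive_iff_positive of_nat_0_less_iff zero_less_Suc)
  have "Cauchy u"
  proof (rule CauchyI)
    fix e :: real assume e: "e > 0"
    then obtain N where N: "inverse (real (Suc N)) < a * e\<^sup>2 / 4"
      using reals_Archimedean[of "a * e\<^sup>2 / 4"] a by auto
    have "norm (u p - u q) < e" if "p \<ge> N" "q \<ge> N" for p q
    proof -
      have "J (u k) < m + a * e\<^sup>2 / 4" if "k \<ge> N" for k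
      proof -
        have "inverse (real (Suc k)) \<le> inverse (real (Suc N))"
          using that by (intro le_imp_inverse_le) auto
        then show ?thesis using u[of k] N by linarith
      qed
      from this[OF that(1)] this[OF that(2)] parallelogram[of "u p" "u q"] u
      have "a / 2 * (norm (u p - u q))\<^sup>2 < a / 2 * e\<^sup>2" by fastforce
      then have "(norm (u p - u q))\<^sup>2 < e\<^sup>2" using a by simp
      then show ?thesis using e by (simp add: power2_less_imp_less)
    qed
    then show "\<exists>N. \<forall>p\<ge>N. \<forall>q\<ge>N. norm (u p - u q) < e" by blast
  qed
  then obtain x where lim: "u \<longlonglongrightarrow> x" using Cauchy_convergent convergent_def by blast
  have x: "x \<in> W" using closed_sequentially[OF W(2) _ lim] u by blast
  have "(\<lambda>n. J (u n)) \<longlonglongrightarrow> J x"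
    unfolding J_def by (intro tendsto_intros B.tendsto f.tendsto lim)
  moreover have "(\<lambda>n. m + inverse (real (Suc n))) \<longlonglongrightarrow> m + 0"
    by (intro tendsto_add tendsto_const LIMSEQ_inverse_real_of_nat)
  ultimately have Jx: "J x \<le> m"
    using u by (intro LIMSEQ_le[of _ _ _ "m"]) (auto intro!: exI[of _ 0] less_imp_le)
  have "B y x = f y" if y: "y \<in> W" for y
  proof -
    define g where "g = B y x - f y"
    have b: "B y y \<ge> 0" using coer[OF y] a by (meson mult_nonneg_nonneg less_imp_le order_trans zero_le_power2)
    \<comment> \<open>Moving from \<open>x\<close> by \<open>t *\<^sub>R y\<close> changes
      \<open>J\<close> by \<open>t * (2 * g + t * B y y)\<close>, which this \<open>t\<close> makes
      negative unless \<open>g = 0\<close>. The added 1 covers \<open>B y y = 0\<close>.\<close>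
    define t where "t = - g / (B y y + 1)"
    have "x + t *\<^sub>R y \<in> W" using x y W by (simp add: subspace_add subspace_scale)
    then have "J x \<le> J (x + t *\<^sub>R y)" using m_le Jx by fastforce
    then have "0 \<le> t * (2 * g + t * B y y)"
      by (simp add: J_def g_def B.add_left B.add_right B.scaleR_left B.scaleR_right f.add f.scaleR
          sym[of x y] algebra_simps)
    also have "\<dots> = - (g\<^sup>2 * (B y y + 2) / (B y y + 1)\<^sup>2)"
      using b by (simp add: t_def field_simps power2_eq_square)
    finally have "g\<^sup>2 * (B y y + 2) / (B y y + 1)\<^sup>2 \<le> 0" by simp
    then have "g\<^sup>2 \<le> 0" using b by (simp add: divide_le_0_iff mult_le_0_iff)
    then show ?thesis by (simp add: g_def)
  qed
  with x that show ?thesis by blast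
qed

text \<open>The real form \<open>re (ipV (T x) (T y))\<close> is coercive on \<open>W\<close>
  because \<open>T\<close> is bounded below there. The identity as \<open>T\<close> gives the usual
  Riesz theorem and orthogonal projections; the analysis operator as \<open>T\<close> gives the
  normal equations behind \<open>R\<close>.\<close>

lemma (in hilbert_space) riesz_form:
  fixes T :: "'h \<Rightarrow> 'v::real_normed_vector" and l :: "'h \<Rightarrow> 'k"
  assumes V: "inner_space smulV ipV"
    and W: "subspace W" "closed W"
    and T: "bounded_linear T" "\<And>s x. T (smul s x) = smulV s (T x)"
    and a: "a > 0" and below: "\<And>x. x \<in> W \<Longrightarrow> a * norm x \<le> norm (T x)"
    and l: "bounded_linear l" "\<And>s x. l (smul s x) = s * l x"
  obtains x where "x \<in> W" "\<And>y. y \<in> W \<Longrightarrow> ipV (T y) (T x) = l y"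
proof -
  interpret V: inner_space smulV ipV by fact
  interpret T: bounded_linear T by fact
  interpret ip: bounded_bilinear ipV by (rule V.bounded_bilinear_ip)
  have coer: "a\<^sup>2 * (norm x)\<^sup>2 \<le> re (ipV (T x) (T x))" if "x \<in> W" for x
    using power_mono[OF below[OF that], of 2] a by (simp add: V.ip_self power_mult_distrib del: of_real_power)
  have bil: "bounded_bilinear (\<lambda>x y. re (ipV (T x) (T y)))"
  proof
    show "\<exists>K. \<forall>x y. norm (re (ipV (T x) (T y))) \<le> norm x * norm y * K"
    proof -
      obtain K where K: "\<And>x y. norm (ipV (T x) (T y)) \<le> norm x * norm y * K"
        using bounded_bilinear.bounded[OF ip.comp[OF T(1) T(1)]] by blast
      show ?thesis
        unfolding real_norm_def by (intro exI[of _ K] allI order_trans[OF abs_re_le K])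
    qed
  qed (simp_all add: T.add T.scaleR ip.add_left ip.add_right ip.scaleR_left ip.scaleR_right
      re_add re_scaleR)
  have sym: "re (ipV (T x) (T y)) = re (ipV (T y) (T x))" for x y
    using V.ip_commute[of "T x" "T y"] by simp
  have lin: "bounded_linear (\<lambda>x. re (l x))"
    by (rule bounded_linear_compose[OF bounded_linear_re l(1)])
  have "a\<^sup>2 > 0" using a by simp
  then obtain x where x: "x \<in> W" and re: "\<And>y. y \<in> W \<Longrightarrow> re (ipV (T y) (T x)) = re (l y)"
    using riesz_symmetric_form[OF subspace_real[OF W(1)] W(2) bil sym _ coer lin] by blast
  have "ipV (T y) (T x) = l y" if y: "y \<in> W" for y
  proof -
    \<comment> \<open>Testing the real identity on the multiple \<open>conjg d\<close> of
      \<open>y\<close> turns the defect into \<open>|d|^2\<close>, which lifts equality of real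
      parts to equality of scalars.\<close>
    define d where "d = ipV (T y) (T x) - l y"
    have "re (conjg d * ipV (T y) (T x)) = re (conjg d * l y)"
      using re[of "smul (conjg d) y"] y W(1) by (simp add: subspace_scale T(2) V.ip_smul_left l(2))
    moreover have "conjg d * ipV (T y) (T x) = conjg d * d + conjg d * l y"
      by (simp add: d_def flip: distrib_left)
    ultimately have "re (conjg d * d) = 0"
      by (simp add: re_add)
    then have "re (of_real ((norm d)\<^sup>2) :: 'k) = 0"
      using mult_conjg[of d] by (simp add: mult.commute)
    then show ?thesis by (simp add: d_def del: of_real_power)
  qed
  with x that show ?thesis by blast
qed

section \<open>Inner product and unit vectors of the sequence space\<close>

lift_definition smul_ell2 :: "'k::real_or_complex \<Rightarrow> 'k ell2 \<Rightarrow> 'k ell2" is "\<lambda>a c n. a * c n"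
  by (simp add: norm_mult power_mult_distrib summable_mult)

lift_definition unit_ell2 :: "nat \<Rightarrow> 'k::real_or_complex ell2" is "\<lambda>n m. if m = n then 1 else 0"
proof -
  fix n
  have "summable (\<lambda>m. if m = n then 1 else 0 :: real)"
    using summable_finite[of "{n}"] by simp
  then show "summable (\<lambda>m. (norm (if m = n then 1 else 0 :: 'k))\<^sup>2)"
    by (rule summable_cong[THEN iffD1, rotated]) auto
qed

definition ip_ell2 :: "'k::real_or_complex ell2 \<Rightarrow> 'k ell2 \<Rightarrow> 'k" where
  "ip_ell2 c d = (\<Sum>n. ell2_nth c n * conjg (ell2_nth d n))"

lemmas ell2_nth_simps [simp] = zero_ell2.rep_eq plus_ell2.rep_eq minus_ell2.rep_eq
  uminus_ell2.rep_eq scaleR_ell2.rep_eq smul_ell2.rep_eq unit_ell2.rep_eq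

lemma ell2_eqI: "(\<And>n. ell2_nth c n = ell2_nth d n) \<Longrightarrow> c = d"
  by (simp add: ell2_nth_inject[symmetric] fun_eq_iff)

lemma summable_ell2_nth: "summable (\<lambda>n. (norm (ell2_nth c n))\<^sup>2)"
  using ell2_nth[of c] by simp

lemma norm_ell2_sq: "(norm c)\<^sup>2 = (\<Sum>n. (norm (ell2_nth c n))\<^sup>2)"
  by (simp add: norm_ell2.rep_eq summable_ell2_nth suminf_nonneg)

lemma ell2_nth_sum: "ell2_nth (sum f A) n = (\<Sum>i\<in>A. ell2_nth (f i) n)"
  by (induction A rule: infinite_finite_induct) auto

lemma summable_ip_ell2:
  "summable (\<lambda>n. ell2_nth c n * conjg (ell2_nth d n :: 'k::real_or_complex))"
proof (rule summable_norm_cancel_real_or_complex, rule summable_comparison_test')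
  show "summable (\<lambda>n. (norm (ell2_nth c n))\<^sup>2 + (norm (ell2_nth d n))\<^sup>2)"
    by (intro summable_add summable_ell2_nth)
  show "norm (norm (ell2_nth c n * conjg (ell2_nth d n)))
      \<le> (norm (ell2_nth c n))\<^sup>2 + (norm (ell2_nth d n))\<^sup>2" for n
  proof -
    have "0 \<le> norm (ell2_nth c n) * norm (ell2_nth d n)" by simp
    then show ?thesis
      using sum_squares_bound[of "norm (ell2_nth c n)" "norm (ell2_nth d n)"]
      unfolding norm_mult norm_conjg real_norm_def abs_mult abs_norm_cancel by linarith
  qed
qed

interpretation ell2: inner_space "smul_ell2 :: 'k::real_or_complex \<Rightarrow> _" ip_ell2
proof
  fix a b :: 'k and c d e :: "'k ell2" and r :: real
  show "smul_ell2 a (c + d) = smul_ell2 a c + smul_ell2 a d"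
    "smul_ell2 (a + b) c = smul_ell2 a c + smul_ell2 b c"
    "smul_ell2 a (smul_ell2 b c) = smul_ell2 (a * b) c" "smul_ell2 1 c = c"
    "smul_ell2 (of_real r) c = r *\<^sub>R c"
    by (rule ell2_eqI; simp add: algebra_simps scaleR_conv_of_real)+
  show "ip_ell2 (c + d) e = ip_ell2 c e + ip_ell2 d e"
    by (simp add: ip_ell2_def distrib_right suminf_add summable_ip_ell2)
  show "ip_ell2 (smul_ell2 a c) d = a * ip_ell2 c d"
    by (simp add: ip_ell2_def mult.assoc suminf_mult summable_ip_ell2)
  show "ip_ell2 d c = conjg (ip_ell2 c d)"
    by (simp add: ip_ell2_def bounded_linear.suminf[OF bounded_linear_conjg summable_ip_ell2]
        conjg_mult mult.commute)
  show "ip_ell2 c c = of_real ((norm c)\<^sup>2)"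
    by (simp only: ip_ell2_def mult_conjg norm_ell2_sq
        bounded_linear.suminf[OF bounded_linear_of_real summable_ell2_nth])
qed

lemma ip_ell2_unit_left: "ip_ell2 (unit_ell2 n) c = conjg (ell2_nth c n)"
proof -
  have "ip_ell2 (unit_ell2 n) c = (\<Sum>m. if m = n then conjg (ell2_nth c m) else 0)"
    by (auto simp: ip_ell2_def intro!: arg_cong[of _ _ suminf])
  then show ?thesis
    using sums_unique[OF sums_single[of n "\<lambda>m. conjg (ell2_nth c m)"]] by simp
qed

lemma ell2_nth_sum_unit:
  "ell2_nth (\<Sum>n<N. smul_ell2 (a n) (unit_ell2 n)) m = (if m < N then a m else 0)"
proof -
  have "ell2_nth (\<Sum>n<N. smul_ell2 (a n) (unit_ell2 n)) m = (\<Sum>n<N. if m = n then a n else 0)"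
    unfolding ell2_nth_sum by (intro sum.cong) auto
  then show ?thesis by simp
qed

lemma norm_sum_unit:
  "(norm (\<Sum>n<N. smul_ell2 (a n) (unit_ell2 n)))\<^sup>2 = (\<Sum>n<N. (norm (a n))\<^sup>2)"
proof -
  have "(\<lambda>m. if m \<in> {..<N} then (norm (a m))\<^sup>2 else 0) sums (\<Sum>n<N. (norm (a n))\<^sup>2)"
    by (rule sums_If_finite_set) simp
  moreover have "(norm (if m < N then a m else 0))\<^sup>2 = (if m \<in> {..<N} then (norm (a m))\<^sup>2 else 0)" for m
    by simp
  ultimately show ?thesis
    by (simp only: norm_ell2_sq ell2_nth_sum_unit sums_iff)
qed

text \<open>The squared distance of \<open>c\<close> from its N-th truncation is the tail of the
  series for \<open>|c|^2\<close>.\<close>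

lemma sums_unit_ell2: "(\<lambda>n. smul_ell2 (ell2_nth c n) (unit_ell2 n)) sums c"
proof -
  let ?s = "\<lambda>N. \<Sum>n<N. smul_ell2 (ell2_nth c n) (unit_ell2 n)"
  let ?q = "\<lambda>n. (norm (ell2_nth c n))\<^sup>2"
  have sq: "(norm (?s N - c))\<^sup>2 = (norm c)\<^sup>2 - (\<Sum>n<N. ?q n)" for N
  proof -
    have "(\<lambda>m. ?q m - (if m \<in> {..<N} then ?q m else 0)) sums ((norm c)\<^sup>2 - (\<Sum>n<N. ?q n))"
      unfolding norm_ell2_sq
      by (intro sums_diff sums_If_finite_set summable_sums summable_ell2_nth) simp
    moreover have "(norm (ell2_nth (?s N - c) m))\<^sup>2 = ?q m - (if m \<in> {..<N} then ?q m else 0)" for m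
      by (simp add: ell2_nth_sum_unit)
    ultimately show ?thesis
      by (simp add: norm_ell2_sq sums_iff)
  qed
  have "(\<lambda>N. \<Sum>n<N. ?q n) \<longlonglongrightarrow> (norm c)\<^sup>2"
    unfolding norm_ell2_sq by (rule summable_LIMSEQ[OF summable_ell2_nth])
  then have "(\<lambda>N. sqrt ((norm c)\<^sup>2 - (\<Sum>n<N. ?q n))) \<longlonglongrightarrow> sqrt ((norm c)\<^sup>2 - (norm c)\<^sup>2)"
    by (intro tendsto_intros)
  then have "(\<lambda>N. norm (?s N - c)) \<longlonglongrightarrow> 0"
    by (simp flip: sq)
  then show ?thesis
    unfolding sums_def by (simp add: tendsto_norm_zero_iff LIM_zero_iff)
qed

section \<open>Bessel sequences\<close>

context hilbert_space
begin

lemma orthogonal_projection: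
  assumes W: "subspace W" "closed W"
  obtains p where "p \<in> W" "\<And>y. y \<in> W \<Longrightarrow> ip (h - p) y = 0" "norm p \<le> norm h"
proof -
  interpret ip: bounded_bilinear ip by (rule bounded_bilinear_ip)
  have "inner_space smul ip" ..
  \<comment> \<open>The projection represents the functional of \<open>h\<close> on
    \<open>W\<close>; here \<open>T\<close> is the identity.\<close>
  from riesz_form[OF this W bounded_linear_ident refl zero_less_one _ ip.bounded_linear_left[of h]]
  obtain p where p: "p \<in> W" "\<And>y. y \<in> W \<Longrightarrow> ip y p = ip y h"
    by (auto simp: ip_smul_left)
  have "norm p * norm p \<le> norm p * norm h"
    using Cauchy_Schwarz[of p h] p(2)[OF p(1)]
    by (metis abs_of_nonneg ip_self norm_of_real power2_eq_square zero_le_power2)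
  then have "norm p \<le> norm h"
    by (cases "p = 0") auto
  moreover have "ip (h - p) y = 0" if "y \<in> W" for y
    using p(2)[OF that] ip_eq_0_commute[of y "h - p"] by (simp add: ip_diff_right)
  ultimately show ?thesis using p(1) that by blast
qed

definition bessel :: "(nat \<Rightarrow> 'h) \<Rightarrow> bool" where
  "bessel f \<longleftrightarrow> (\<exists>B>0. \<forall>h. summable (\<lambda>n. (norm (ip h (f n)))\<^sup>2) \<and>
     (\<Sum>n. (norm (ip h (f n)))\<^sup>2) \<le> B * (norm h)\<^sup>2)"

text \<open>The vectors \<open>f n\<close> lie in \<open>W\<close>, so \<open>ip h (f n)\<close>
  sees only the orthogonal projection of \<open>h\<close> onto \<open>W\<close>, whose norm is no
  larger.\<close>

lemma frame_bessel:
  assumes W: "subspace W" "closed W" and f: "is_frame ip W f"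
  shows "bessel f"
proof -
  obtain B where B: "B > 0" "\<And>h. h \<in> W \<Longrightarrow> summable (\<lambda>n. (norm (ip h (f n)))\<^sup>2) \<and>
     (\<Sum>n. (norm (ip h (f n)))\<^sup>2) \<le> B * (norm h)\<^sup>2"
    using f by (auto simp: is_frame_def)
  have "summable (\<lambda>n. (norm (ip h (f n)))\<^sup>2) \<and> (\<Sum>n. (norm (ip h (f n)))\<^sup>2) \<le> B * (norm h)\<^sup>2" for h
  proof -
    obtain p where p: "p \<in> W" "\<And>y. y \<in> W \<Longrightarrow> ip (h - p) y = 0" "norm p \<le> norm h"
      using orthogonal_projection[OF W] by blast
    have "f n \<in> W" for n using f by (auto simp: is_frame_def)
    then have "ip h (f n) = ip p (f n)" for n
      using p(2)[of "f n"] by (simp add: ip_diff_left)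
    moreover have "B * (norm p)\<^sup>2 \<le> B * (norm h)\<^sup>2"
      using p(3) B(1) by (simp add: power_mono)
    ultimately show ?thesis
      using B(2)[OF p(1)] by auto
  qed
  with B(1) show ?thesis by (auto simp: bessel_def)
qed

lemma ell2_nth_analysis:
  assumes "bessel f" shows "ell2_nth (analysis ip f h) n = ip h (f n)"
  using assms by (auto simp: bessel_def analysis_def Abs_ell2_inverse)

lemma norm_analysis:
  assumes "bessel f" shows "(norm (analysis ip f h))\<^sup>2 = (\<Sum>n. (norm (ip h (f n)))\<^sup>2)"
  by (simp add: norm_ell2_sq ell2_nth_analysis[OF assms])

lemma analysis_smul:
  assumes "bessel f" shows "analysis ip f (smul a h) = smul_ell2 a (analysis ip f h)"
  by (rule ell2_eqI) (simp add: ell2_nth_analysis[OF assms] ip_smul_left)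

lemma bounded_linear_analysis:
  assumes f: "bessel f" shows "bounded_linear (analysis ip f)"
proof -
  obtain B where B: "B > 0" "\<And>h. (\<Sum>n. (norm (ip h (f n)))\<^sup>2) \<le> B * (norm h)\<^sup>2"
    using f by (auto simp: bessel_def)
  show ?thesis
  proof (rule bounded_linear_intro)
    show "norm (analysis ip f h) \<le> norm h * sqrt B" for h
      by (rule power2_le_imp_le)
        (use B in \<open>auto simp: norm_analysis[OF f] power_mult_distrib mult.commute\<close>)
  qed (rule ell2_eqI, simp add: ell2_nth_analysis[OF f] ip_add_left ip_scaleR_left)+
qed

section \<open>Bounded operators on the sequence space and their Bessel sequences\<close>

context
  fixes M :: "'k ell2 \<Rightarrow> 'h"
  assumes M: "bounded_linear M" and M_smul: "\<And>a c. M (smul_ell2 a c) = smul a (M c)"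
begin

lemma operator_sums: "(\<lambda>n. smul (ell2_nth c n) (M (unit_ell2 n))) sums M c"
  using bounded_linear.sums[OF M sums_unit_ell2[of c]] by (simp add: M_smul)

lemma synthesis_operator: "synthesis smul (\<lambda>n. M (unit_ell2 n)) c = M c"
  unfolding synthesis_def by (rule sums_unique[OF operator_sums, symmetric])

lemma bessel_operator: "bessel (\<lambda>n. M (unit_ell2 n))"
proof -
  interpret M: bounded_linear M by fact
  obtain K where K: "K > 0" "\<And>c. norm (M c) \<le> norm c * K" using M.pos_bounded by blast
  let ?F = "\<lambda>n. M (unit_ell2 n)"
  have part: "(\<Sum>n<N. (norm (ip h (?F n)))\<^sup>2) \<le> K\<^sup>2 * (norm h)\<^sup>2" for h N
  proof -
    define s where "s = (\<Sum>n<N. (norm (ip h (?F n)))\<^sup>2)"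
    have s: "s \<ge> 0" by (simp add: s_def sum_nonneg)
    \<comment> \<open>Testing \<open>M\<close> on the truncated coefficients of \<open>h\<close>
      gives \<open>s \<le> sqrt s * K * norm h\<close>, and one factor \<open>sqrt s\<close>
      cancels.\<close>
    define c where "c = (\<Sum>n<N. smul_ell2 (ip h (?F n)) (unit_ell2 n))"
    have c: "norm c = sqrt s"
      using norm_sum_unit[of "\<lambda>n. ip h (?F n)" N] by (simp add: c_def s_def real_sqrt_unique)
    have "ip (M c) h = (\<Sum>n<N. ip h (?F n) * ip (?F n) h)"
      by (simp add: c_def M.sum M_smul bounded_bilinear.sum_left[OF bounded_bilinear_ip] ip_smul_left)
    also have "\<dots> = of_real s"
      by (simp add: s_def ip_commute[of _ h] mult_conjg flip: of_real_power)
    finally have "s = norm (ip (M c) h)"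
      using s by simp
    also have "\<dots> \<le> sqrt s * K * norm h"
      using Cauchy_Schwarz[of "M c" h] K(2)[of c] c
      by (metis mult_right_mono norm_ge_zero order_trans)
    finally have "sqrt s * sqrt s \<le> sqrt s * (K * norm h)"
      using s by (simp add: mult.assoc)
    then have "sqrt s \<le> K * norm h"
      using K(1) s by (cases "s = 0") (auto simp: mult_le_cancel_left_pos simp del: real_sqrt_mult_self)
    then have "(sqrt s)\<^sup>2 \<le> (K * norm h)\<^sup>2"
      using s by (intro power_mono) auto
    then show ?thesis
      using s by (simp add: s_def power_mult_distrib)
  qed
  have sm: "summable (\<lambda>n. (norm (ip h (?F n)))\<^sup>2)" for h
    by (rule bounded_imp_summable[of _ "K\<^sup>2 * (norm h)\<^sup>2"])
      (use part[of h "Suc _"] in \<open>auto simp: lessThan_Suc_atMost\<close>)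
  show ?thesis
    unfolding bessel_def
    using K(1) sm suminf_le_const[OF sm part] by (intro exI[of _ "K\<^sup>2"]) auto
qed

text \<open>The analysis operator of the images of the unit vectors is the adjoint of
  \<open>M\<close>.\<close>

lemma ip_operator: "ip (M c) h = ip_ell2 c (analysis ip (\<lambda>n. M (unit_ell2 n)) h)"
proof -
  have "(\<lambda>n. ip (smul (ell2_nth c n) (M (unit_ell2 n))) h) sums ip (M c) h"
    by (rule bounded_linear.sums[OF
          bounded_bilinear.bounded_linear_left[OF bounded_bilinear_ip] operator_sums])
  then show ?thesis
    unfolding ip_ell2_def ell2_nth_analysis[OF bessel_operator]
    by (simp add: sums_iff ip_smul_left flip: ip_commute)
qed

end

end

section \<open>Oblique duals\<close>

context hilbert_space
begin

lemma subspace_orth_compl: "subspace (orth_compl ip W)"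
  by (auto simp: subspace_def orth_compl_def ip_add_left ip_smul_left)

lemma closed_orth_compl: "closed (orth_compl ip W)"
proof -
  have "orth_compl ip W = (\<Inter>w\<in>W. {h. ip h w = 0})"
    by (auto simp: orth_compl_def)
  moreover have "closed {h. ip h w = 0}" for w
    by (intro closed_Collect_eq continuous_on_const linear_continuous_on
        bounded_bilinear.bounded_linear_left[OF bounded_bilinear_ip])
  ultimately show ?thesis by auto
qed

end

locale oblique_frame = hilbert_space smul ip
  for smul :: "'k::real_or_complex \<Rightarrow> 'h::banach \<Rightarrow> 'h" and ip :: "'h \<Rightarrow> 'h \<Rightarrow> 'k" +
  fixes W1 W2 :: "'h set" and \<Phi> :: "nat \<Rightarrow> 'h"
  assumes W1: "subspace W1" "closed W1" and W2: "subspace W2" "closed W2"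
    and direct: "is_direct_sum W1 (orth_compl ip W2)"
    and frame: "is_frame ip W2 \<Phi>"
begin

abbreviation "Z \<equiv> orth_compl ip W2"
abbreviation "\<pi> \<equiv> oblique_proj W1 Z"

section \<open>The oblique projection\<close>

lemma trivial_intersection: "W1 \<inter> Z = {0}"
  using direct by (simp add: is_direct_sum_def)

lemma decomposition: "\<exists>x\<in>W1. \<exists>z\<in>Z. h = x + z"
  using direct UNIV_I[of h] unfolding is_direct_sum_def by blast

lemma proj_eqI:
  assumes "x \<in> W1" "h - x \<in> Z" shows "\<pi> h = x"
  unfolding oblique_proj_def
proof (rule the_equality)
  show "x \<in> W1 \<and> (\<exists>z\<in>Z. h = x + z)"
    using assms by (auto intro!: bexI[of _ "h - x"])
  fix y assume y: "y \<in> W1 \<and> (\<exists>z\<in>Z. h = y + z)"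
  then have "h - y \<in> Z" by auto
  then have "(h - x) - (h - y) \<in> Z"
    using assms(2) subspace_orth_compl subspace_diff by blast
  moreover have "y - x \<in> W1" using y assms(1) W1 subspace_diff by blast
  ultimately have "y - x \<in> W1 \<inter> Z" by (simp add: algebra_simps)
  then show "y = x" using trivial_intersection by simp
qed

lemma proj: "\<pi> h \<in> W1" "h - \<pi> h \<in> Z"
proof -
  obtain x z where "x \<in> W1" "z \<in> Z" "h = x + z" using decomposition by blast
  moreover from this have "\<pi> h = x" by (intro proj_eqI) auto
  ultimately show "\<pi> h \<in> W1" "h - \<pi> h \<in> Z" by auto
qed

lemma proj_id: "x \<in> W1 \<Longrightarrow> \<pi> x = x"
  using subspace_orth_compl by (intro proj_eqI) (auto simp: subspace_0)

lemma proj_smul: "\<pi> (smul a h) = smul a (\<pi> h)"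
proof (rule proj_eqI)
  have "smul a h - smul a (\<pi> h) = smul a (h - \<pi> h)"
    by (simp add: scale_right_diff_distrib)
  then show "smul a h - smul a (\<pi> h) \<in> Z"
    using proj subspace_orth_compl by (simp add: subspace_scale)
qed (use proj W1 in \<open>simp add: subspace_scale\<close>)

lemma bounded_linear_proj: "bounded_linear \<pi>"
proof -
  obtain C where C: "\<And>x z. x \<in> W1 \<Longrightarrow> z \<in> Z \<Longrightarrow> norm x \<le> C * norm (x + z)"
    using direct_sum_projection_bounded[OF subspace_real[OF W1(1)] W1(2)
        subspace_real[OF subspace_orth_compl] closed_orth_compl trivial_intersection decomposition]
    by metis
  show ?thesis
  proof (rule bounded_linear_intro)
    show "\<pi> (g + h) = \<pi> g + \<pi> h" for g h
    proof (rule proj_eqI)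
      have "(g + h) - (\<pi> g + \<pi> h) = (g - \<pi> g) + (h - \<pi> h)" by simp
      then show "(g + h) - (\<pi> g + \<pi> h) \<in> Z"
        using proj subspace_orth_compl by (metis subspace_add)
    qed (use proj W1 in \<open>simp add: subspace_add\<close>)
    show "\<pi> (r *\<^sub>R h) = r *\<^sub>R \<pi> h" for r h
      using proj_smul[of "of_real r" h] by (simp add: smul_of_real)
    show "norm (\<pi> h) \<le> norm h * C" for h
      using C[OF proj, of h h] by (simp add: mult.commute)
  qed
qed

lemma proj_eq_iff: "\<pi> g = \<pi> h \<longleftrightarrow> g - h \<in> Z"
proof
  assume "\<pi> g = \<pi> h"
  then show "g - h \<in> Z"
    using subspace_diff[OF subspace_orth_compl proj(2)[of g] proj(2)[of h]] by simp
next
  assume "g - h \<in> Z"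
  then show "\<pi> g = \<pi> h"
    using subspace_add[OF subspace_orth_compl _ proj(2)[of h], of "g - h"]
    by (intro proj_eqI proj) simp
qed

lemma bessel_frame: "is_frame ip W2 f \<Longrightarrow> bessel f"
  by (rule frame_bessel[OF W2])

text \<open>Elements of \<open>Z\<close> are orthogonal to every frame vector in \<open>W2\<close>.
  In particular \<open>T h = T (\<pi> h)\<close>.\<close>

lemma analysis_eq:
  assumes f: "is_frame ip W2 f" and gh: "g - h \<in> Z"
  shows "analysis ip f g = analysis ip f h"
proof (rule ell2_eqI)
  fix n
  have "f n \<in> W2" using f by (auto simp: is_frame_def)
  with gh have "ip (g - h) (f n) = 0" by (auto simp: orth_compl_def)
  then show "ell2_nth (analysis ip f g) n = ell2_nth (analysis ip f h) n"
    by (simp add: ell2_nth_analysis[OF bessel_frame[OF f]] ip_diff_left)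
qed

section \<open>The analysis operator of the frame and its left inverse\<close>

abbreviation "T \<equiv> analysis ip \<Phi>"

lemmas bounded_linear_T = bounded_linear_analysis[OF bessel_frame[OF frame]]
lemmas T_smul = analysis_smul[OF bessel_frame[OF frame]]
lemmas T_nth = ell2_nth_analysis[OF bessel_frame[OF frame]]

lemma T_in_W2: "\<exists>y\<in>W2. h - y \<in> Z \<and> T h = T y"
proof -
  obtain y where "y \<in> W2" "\<And>w. w \<in> W2 \<Longrightarrow> ip (h - y) w = 0"
    using orthogonal_projection[OF W2] by metis
  then show ?thesis
    using analysis_eq[OF frame, of h y] by (auto simp: orth_compl_def)
qed

lemma T_bounded_below: "\<exists>a>0. \<forall>x\<in>W2. a * norm x \<le> norm (T x)"
proof -
  obtain A where A: "A > 0" "\<And>x. x \<in> W2 \<Longrightarrow> A * (norm x)\<^sup>2 \<le> (\<Sum>n. (norm (ip x (\<Phi> n)))\<^sup>2)"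
    using frame unfolding is_frame_def by blast
  have "sqrt A * norm x \<le> norm (T x)" if "x \<in> W2" for x
    by (rule power2_le_imp_le)
      (use A that in \<open>auto simp: power_mult_distrib norm_analysis[OF bessel_frame[OF frame]]\<close>)
  with A(1) show ?thesis by (intro exI[of _ "sqrt A"]) simp
qed

lemma T_inj: "x \<in> W2 \<Longrightarrow> y \<in> W2 \<Longrightarrow> T x = T y \<Longrightarrow> x = y"
proof -
  assume xy: "x \<in> W2" "y \<in> W2" "T x = T y"
  obtain a where a: "a > 0" "\<And>x. x \<in> W2 \<Longrightarrow> a * norm x \<le> norm (T x)"
    using T_bounded_below by blast
  have "a * norm (x - y) \<le> norm (T (x - y))"
    using a(2) xy W2 subspace_diff by blast
  also have "T (x - y) = 0"
    using xy bounded_linear.linear[OF bounded_linear_T] by (simp add: linear_diff)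
  finally show ?thesis using a(1) by (simp add: mult_le_0_iff)
qed

text \<open>\<open>R c\<close> is the element of \<open>W2\<close> whose analysis is the orthogonal projection of \<open>c\<close> onto the range
  of \<open>T\<close>; in terms of the frame operator it is \<open>S\<^sup>-\<^sup>1 T\<^sup>* c\<close>.\<close>

definition R :: "'k ell2 \<Rightarrow> 'h" where
  "R c = (THE x. x \<in> W2 \<and> (\<forall>h. ip_ell2 (T h) (c - T x) = 0))"

lemma R_unique:
  assumes "x \<in> W2" "\<And>h. ip_ell2 (T h) (c - T x) = 0"
  shows "R c = x"
  unfolding R_def
proof (rule the_equality)
  fix y assume y: "y \<in> W2 \<and> (\<forall>h. ip_ell2 (T h) (c - T y) = 0)"
  have *: "ip_ell2 (T h) (T y - T x) = 0" for h
    using assms(2)[of h] y by (simp add: ell2.ip_diff_right)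
  then have "ip_ell2 (T y - T x) (T y - T x) = 0"
    by (simp only: ell2.ip_diff_left * diff_self)
  then show "y = x" using T_inj y assms(1) by (simp del: ell2_nth_simps)
qed (use assms in blast)

lemma R: "R c \<in> W2" "ip_ell2 (T h) (c - T (R c)) = 0"
proof -
  interpret T: bounded_linear T by (rule bounded_linear_T)
  obtain a where a: "a > 0" "\<And>x. x \<in> W2 \<Longrightarrow> a * norm x \<le> norm (T x)"
    using T_bounded_below by blast
  have "bounded_linear (\<lambda>y. ip_ell2 (T y) c)"
    by (rule bounded_linear_compose[OF
          bounded_bilinear.bounded_linear_left[OF ell2.bounded_bilinear_ip] bounded_linear_T])
  from riesz_form[OF ell2.inner_space_axioms W2 bounded_linear_T T_smul a this]
  obtain x where x: "x \<in> W2" "\<And>y. y \<in> W2 \<Longrightarrow> ip_ell2 (T y) (T x) = ip_ell2 (T y) c"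
    by (auto simp: T_smul ell2.ip_smul_left)
  \<comment> \<open>Orthogonality to \<open>T y\<close> for \<open>y\<close> in \<open>W2\<close>
    extends to all \<open>h\<close>, as \<open>T\<close> takes all its values on
    \<open>W2\<close>.\<close>
  have *: "ip_ell2 (T h) (c - T x) = 0" for h
    using T_in_W2[of h] x(2) by (auto simp: ell2.ip_diff_right)
  then have "R c = x" using R_unique x(1) by blast
  with x(1) * show "R c \<in> W2" "ip_ell2 (T h) (c - T (R c)) = 0" by auto
qed

lemma R_smul: "R (smul_ell2 s c) = smul s (R c)"
proof (rule R_unique)
  have "smul_ell2 s c - T (smul s (R c)) = smul_ell2 s (c - T (R c))"
    by (simp add: T_smul ell2.scale_right_diff_distrib)
  then show "ip_ell2 (T h) (smul_ell2 s c - T (smul s (R c))) = 0" for h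
    by (simp add: ell2.ip_smul_right R)
qed (use R W2 in \<open>simp add: subspace_scale\<close>)

lemma bounded_linear_R: "bounded_linear R"
proof -
  interpret T: bounded_linear T by (rule bounded_linear_T)
  obtain a where a: "a > 0" "\<And>x. x \<in> W2 \<Longrightarrow> a * norm x \<le> norm (T x)"
    using T_bounded_below by blast
  show ?thesis
  proof (rule bounded_linear_intro)
    show "R (c + d) = R c + R d" for c d
    proof (rule R_unique)
      have "c + d - T (R c + R d) = (c - T (R c)) + (d - T (R d))"
        by (simp add: T.add)
      then show "ip_ell2 (T h) (c + d - T (R c + R d)) = 0" for h
        by (simp only: ell2.ip_add_right R add_0)
    qed (use R W2 in \<open>simp add: subspace_add\<close>)
    show "R (r *\<^sub>R c) = r *\<^sub>R R c" for r c
      using R_smul[of "of_real r" c] by (simp add: smul_of_real ell2.smul_of_real)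
    show "norm (R c) \<le> norm c * (1 / a)" for c
    proof -
      have "ip_ell2 (T (R c)) (T (R c)) = ip_ell2 (T (R c)) c"
        using R(2)[of "R c" c] by (simp add: ell2.ip_diff_right)
      then have "norm (T (R c)) * norm (T (R c)) \<le> norm (T (R c)) * norm c"
        using ell2.Cauchy_Schwarz[of "T (R c)" c]
        by (metis abs_of_nonneg ell2.ip_self norm_of_real power2_eq_square zero_le_power2)
      then have "norm (T (R c)) \<le> norm c"
        by (cases "T (R c) = 0") auto
      then show ?thesis
        using a(2)[OF R(1), of c] a(1) by (simp add: field_simps)
    qed
  qed
qed

text \<open>\<open>R (T h)\<close> is the orthogonal projection of \<open>h\<close> onto
  \<open>W2\<close>; it differs from \<open>h\<close> by an element of \<open>Z\<close>, the kernel
  of \<open>\<pi>\<close>.\<close>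

lemma proj_R_T: "\<pi> (R (T h)) = \<pi> h"
proof -
  obtain y where y: "y \<in> W2" "h - y \<in> Z" "T h = T y" using T_in_W2 by blast
  then have "R (T h) = y" by (intro R_unique) auto
  then show ?thesis using y(2) proj_eq_iff[of h y] by simp
qed

text \<open>The upper frame bound is the Bessel bound. For the lower one, \<open>M (T h) = h\<close>
  on \<open>W1\<close>, so \<open>|h|^2\<close> is the inner product of \<open>T h\<close> with the
  analysis of \<open>h\<close>; Cauchy-Schwarz gives \<open>1 / K^2\<close> for a bound
  \<open>K\<close> of \<open>T\<close>.\<close>

lemma dual_of_left_inverse:
  assumes M: "bounded_linear M" "\<And>a c. M (smul_ell2 a c) = smul a (M c)"
    and range: "\<And>c. M c \<in> W1" and inv: "\<And>h. M (T h) = \<pi> h"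
  shows "(\<lambda>n. M (unit_ell2 n)) \<in> oblique_duals smul ip W1 W2 \<Phi>"
proof -
  let ?F = "\<lambda>n. M (unit_ell2 n)"
  have F: "bessel ?F" by (rule bessel_operator[OF M])
  then obtain B where B: "B > 0"
    "\<And>h. summable (\<lambda>n. (norm (ip h (?F n)))\<^sup>2) \<and> (\<Sum>n. (norm (ip h (?F n)))\<^sup>2) \<le> B * (norm h)\<^sup>2"
    unfolding bessel_def by blast
  obtain K where K: "K > 0" "\<And>x. norm (T x) \<le> norm x * K"
    using bounded_linear.pos_bounded[OF bounded_linear_T] by blast
  have lower: "1 / K\<^sup>2 * (norm h)\<^sup>2 \<le> (\<Sum>n. (norm (ip h (?F n)))\<^sup>2)" if h: "h \<in> W1" for h
  proof -
    have "norm h * norm h = norm (ip (M (T h)) h)"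
      unfolding inv proj_id[OF h] ip_self norm_of_real by (simp add: power2_eq_square)
    also have "\<dots> = norm (ip_ell2 (T h) (analysis ip ?F h))"
      by (simp add: ip_operator[OF M])
    also have "\<dots> \<le> norm (T h) * norm (analysis ip ?F h)"
      by (rule ell2.Cauchy_Schwarz)
    also have "\<dots> \<le> norm h * K * norm (analysis ip ?F h)"
      by (intro mult_right_mono K norm_ge_zero)
    finally have "norm h \<le> K * norm (analysis ip ?F h)"
      using K(1) by (cases "h = 0") auto
    then have "(norm h)\<^sup>2 \<le> (K * norm (analysis ip ?F h))\<^sup>2"
      by (intro power_mono) auto
    then show ?thesis
      using K(1) by (simp add: norm_analysis[OF F] power_mult_distrib field_simps)
  qed
  have "is_frame ip W1 ?F"
    unfolding is_frame_def
  proof (intro conjI exI ballI)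
    show "range ?F \<subseteq> W1" using range by auto
    show "1 / K\<^sup>2 > 0" "B > 0" using K(1) B(1) by auto
  qed (use B(2) lower in auto)
  moreover have "synthesis smul ?F \<circ> T = \<pi>"
    by (simp add: fun_eq_iff synthesis_operator[OF M] inv)
  ultimately show ?thesis by (simp add: oblique_duals_def)
qed

section \<open>Rank one perturbations of the left inverse\<close>

definition dual_op :: "'k ell2 \<Rightarrow> 'h \<Rightarrow> 'k ell2 \<Rightarrow> 'h" where
  "dual_op m u c = \<pi> (R c) + smul (ip_ell2 c m) u"

lemma bounded_linear_dual_op: "bounded_linear (dual_op m u)"
proof -
  have "bounded_linear (\<lambda>a. smul a u)"
    by (rule bounded_linear_intro[where K = "norm u"])
      (simp_all add: scale_left_distrib norm_smul scaleR_conv_of_real smul_of_real flip: scale_scale)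
  then show ?thesis
    unfolding dual_op_def
    by (intro bounded_linear_add bounded_linear_compose[OF bounded_linear_proj bounded_linear_R]
        bounded_linear_compose[OF _ bounded_bilinear.bounded_linear_left[OF ell2.bounded_bilinear_ip]])
qed

lemma dual_op_smul: "dual_op m u (smul_ell2 a c) = smul a (dual_op m u c)"
  by (simp add: dual_op_def R_smul proj_smul ell2.ip_smul_left scale_right_distrib)

lemma dual_op_dual:
  assumes "u \<in> W1" "\<And>h. ip_ell2 (T h) m = 0"
  shows "(\<lambda>n. dual_op m u (unit_ell2 n)) \<in> oblique_duals smul ip W1 W2 \<Phi>"
proof (rule dual_of_left_inverse[OF bounded_linear_dual_op dual_op_smul])
  show "dual_op m u c \<in> W1" for c
    unfolding dual_op_def by (intro subspace_add W1 proj subspace_scale assms)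
  show "dual_op m u (T h) = \<pi> h" for h
    by (simp add: dual_op_def assms proj_R_T)
qed

lemma range_analysis_dual:
  assumes "R c \<noteq> 0"
  shows "\<exists>F\<in>oblique_duals smul ip W1 W2 \<Phi>. c \<in> range (analysis ip F)"
proof -
  interpret T: bounded_linear T by (rule bounded_linear_T)
  define y where "y = R c"
  define m where "m = c - T y"
  have m: "ip_ell2 (T h) m = 0" for h by (simp add: m_def y_def R)
  have y: "y \<in> W2" by (simp add: y_def R)
  have Ty: "ip_ell2 (T y) (T y) \<noteq> 0"
    using T_inj[of y 0] y W2 assms by (auto simp: y_def subspace_0 T.zero)
  have "bounded_linear (\<lambda>v. ip_ell2 (T v) (T y))"
    by (rule bounded_linear_compose[OF
          bounded_bilinear.bounded_linear_left[OF ell2.bounded_bilinear_ip] bounded_linear_T])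
  \<comment> \<open>This \<open>h\<close> is chosen so that the adjoint of
    \<open>\<pi> \<circ> R\<close> sends it to \<open>T y\<close>.\<close>
  from riesz_form[OF inner_space_axioms W1 bounded_linear_ident refl zero_less_one _ this]
  obtain h where h: "h \<in> W1" "\<And>v. v \<in> W1 \<Longrightarrow> ip v h = ip_ell2 (T v) (T y)"
    by (auto simp: T_smul ell2.ip_smul_left)
  have "h \<noteq> 0"
  proof
    assume "h = 0"
    \<comment> \<open>\<open>\<pi> y\<close> is a test vector in \<open>W1\<close> with the same
      analysis as \<open>y\<close>.\<close>
    then have "ip_ell2 (T (\<pi> y)) (T y) = 0" using h(2)[OF proj(1)] by simp
    moreover have "T (\<pi> y) = T y" using proj(2)[of y] by (metis analysis_eq frame)
    ultimately show False using Ty by simp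
  qed
  \<comment> \<open>Normalised to \<open>ip u h = 1\<close>: the adjoint of the rank one term then
    sends \<open>h\<close> to \<open>m\<close>, and \<open>T y + m = c\<close>.\<close>
  define u where "u = h /\<^sub>R (norm h)\<^sup>2"
  have u: "u \<in> W1"
    unfolding u_def using h(1) subspace_real[OF W1(1)] by (rule Real_Vector_Spaces.subspace_scale[rotated])
  have uh: "ip u h = 1"
    using \<open>h \<noteq> 0\<close> by (simp add: u_def ip_scaleR_left ip_self scaleR_conv_of_real flip: of_real_mult of_real_power)
  let ?F = "\<lambda>n. dual_op m u (unit_ell2 n)"
  have *: "ip (dual_op m u d) h = ip_ell2 d c" for d
  proof -
    have "ip (\<pi> (R d)) h = ip_ell2 (T (\<pi> (R d))) (T y)"
      by (rule h(2)[OF proj(1)])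
    also have "T (\<pi> (R d)) = T (R d)"
      using proj(2)[of "R d"] by (metis analysis_eq frame)
    also have "ip_ell2 (T (R d)) (T y) = ip_ell2 d (T y)"
    proof -
      have "ip_ell2 (d - T (R d)) (T y) = 0"
        using R(2) ell2.ip_eq_0_commute by blast
      then show ?thesis by (simp add: ell2.ip_diff_left)
    qed
    finally show ?thesis
      by (simp add: dual_op_def ip_add_left ip_smul_left uh m_def ell2.ip_diff_right)
  qed
  have "analysis ip ?F h = c"
  proof (rule ell2_eqI)
    fix n
    have "ell2_nth (analysis ip ?F h) n = conjg (ip (?F n) h)"
      unfolding ell2_nth_analysis[OF bessel_operator[OF bounded_linear_dual_op dual_op_smul]]
      by (rule ip_commute)
    then show "ell2_nth (analysis ip ?F h) n = ell2_nth c n"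
      by (simp add: * ip_ell2_unit_left)
  qed
  then show ?thesis
    using dual_op_dual[OF u m] by blast
qed

text \<open>Sequences with \<open>R c \<noteq> 0\<close> lie in some range already; the others are
  approximated by such sequences. If \<open>W1 = {0}\<close>, every dual is the zero sequence and
  the union of the ranges is \<open>{0}\<close>, hence the assumption.\<close>

lemma closure_ranges:
  assumes "W1 \<noteq> {0}"
  shows "closure (\<Union>F\<in>oblique_duals smul ip W1 W2 \<Phi>. range (analysis ip F)) = UNIV"
proof -
  interpret R: bounded_linear R by (rule bounded_linear_R)
  have "\<exists>d\<in>(\<Union>F\<in>oblique_duals smul ip W1 W2 \<Phi>. range (analysis ip F)). dist d c < e"
    if e: "e > 0" for c e
  proof (cases "R c = 0")
    case False
    then show ?thesis using range_analysis_dual[of c] e by (intro bexI[of _ c]) auto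
  next
    case True
    obtain v where v: "v \<in> W1" "v \<noteq> 0" using assms subspace_0[OF W1(1)] by blast
    \<comment> \<open>A direction in which \<open>R\<close> does not vanish:
      \<open>\<pi> (R (T v)) = v\<close>.\<close>
    have "\<pi> (R (T v)) \<noteq> 0" using v by (simp add: proj_R_T proj_id)
    then have Rv: "R (T v) \<noteq> 0" using proj_id[of 0] subspace_0[OF W1(1)] by metis
    \<comment> \<open>Makes the perturbation shorter than \<open>e\<close>; the added 1 keeps the
      denominator positive without a separate bound on \<open>norm (T v)\<close>.\<close>
    define t where "t = e / (2 * (norm (T v) + 1))"
    have t: "t > 0" using e by (simp add: t_def add_nonneg_pos)
    define d where "d = c + t *\<^sub>R T v"
    have "R d \<noteq> 0" using Rv True t by (simp add: d_def R.add R.scaleR)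
    moreover have "dist d c < e"
    proof -
      have "dist d c = t * norm (T v)" using t by (simp add: d_def dist_norm)
      also have "\<dots> < t * (2 * (norm (T v) + 1))" using t by (simp add: add_nonneg_pos)
      also have "\<dots> = e" by (simp add: t_def add_nonneg_eq_0_iff)
      finally show ?thesis .
    qed
    ultimately show ?thesis using range_analysis_dual[of d] by blast
  qed
  then show ?thesis by (auto simp: set_eq_iff closure_approachable)
qed

lemma frame_unique:
  assumes G: "is_frame ip W2 G"
    and sub: "oblique_duals smul ip W1 W2 \<Phi> \<subseteq> oblique_duals smul ip W1 W2 G"
  shows "\<Phi> = G"
proof (cases "W1 = {0}")
  case True
  \<comment> \<open>In the degenerate case \<open>Z\<close> is the whole space, so both frames
    consist of zeros.\<close>
  have "W2 = {0}"
  proof -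
    have "w = 0" if "w \<in> W2" for w
    proof -
      have "w \<in> Z" using decomposition[of w] True by auto
      with that have "ip w w = 0" by (auto simp: orth_compl_def)
      then show ?thesis by simp
    qed
    then show ?thesis using subspace_0[OF W2(1)] by blast
  qed
  then show ?thesis using frame G by (auto simp: is_frame_def fun_eq_iff image_subset_iff)
next
  case False
  then obtain u where u: "u \<in> W1" "u \<noteq> 0" using subspace_0[OF W1(1)] by blast
  have dual_G: "dual_op m v (analysis ip G h) = \<pi> h"
    if "v \<in> W1" "\<And>h. ip_ell2 (T h) m = 0" for m v h
  proof -
    have "synthesis smul (\<lambda>n. dual_op m v (unit_ell2 n)) \<circ> analysis ip G = \<pi>"
      using dual_op_dual[OF that] sub by (auto simp: oblique_duals_def)
    then show ?thesis
      by (simp add: fun_eq_iff synthesis_operator[OF bounded_linear_dual_op dual_op_smul])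
  qed
  have "analysis ip G h = T h" for h
  proof -
    define a where "a = analysis ip G h"
    define m where "m = a - T (R a)"
    have m: "ip_ell2 (T x) m = 0" for x by (simp add: m_def R)
    \<comment> \<open>The unperturbed dual (\<open>m = 0\<close>, \<open>u = 0\<close>) is compared
      with the perturbation along \<open>m\<close> and \<open>u \<noteq> 0\<close>: both invert the
      analysis of \<open>G\<close>, so the rank one term vanishes at \<open>a\<close>.\<close>
    have Ra: "\<pi> (R a) = \<pi> h"
      using dual_G[of 0 0 h] W1 by (simp add: dual_op_def a_def subspace_0)
    moreover have "\<pi> (R a) + smul (ip_ell2 a m) u = \<pi> h"
      using dual_G[OF u(1) m, of h] by (simp add: dual_op_def a_def)
    ultimately have "ip_ell2 a m = 0" using u(2) by simp
    \<comment> \<open>\<open>T (R a)\<close> is orthogonal to \<open>m\<close>, so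
      \<open>ip_ell2 m m = ip_ell2 a m\<close>; hence \<open>a\<close> lies in the range of
      \<open>T\<close>.\<close>
    then have "ip_ell2 m m = 0"
      using m[of "R a"] by (subst (1) m_def) (simp add: ell2.ip_diff_left)
    then have "a = T (R a)" by (simp add: m_def)
    \<comment> \<open>\<open>Ra\<close> places \<open>R a - h\<close> in \<open>Z\<close>, which
      \<open>T\<close> ignores.\<close>
    also have "\<dots> = T h" using Ra analysis_eq[OF frame] by (simp add: proj_eq_iff)
    finally show ?thesis by (simp add: a_def)
  qed
  then have eq: "ip h (\<Phi> n) = ip h (G n)" for h n
    by (metis T_nth ell2_nth_analysis[OF bessel_frame[OF G]])
  have "\<Phi> n = G n" for n
  proof -
    have "ip (\<Phi> n - G n) (\<Phi> n - G n) = 0" by (simp add: ip_diff_right eq)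
    then show ?thesis by simp
  qed
  then show ?thesis by blast
qed

end

theorem proposition4p2:
  fixes smul :: "'k::real_or_complex \<Rightarrow> 'h::banach \<Rightarrow> 'h"
    and ip :: "'h \<Rightarrow> 'h \<Rightarrow> 'k"
    and W1 W2 :: "'h set"
    and \<Phi> :: "nat \<Rightarrow> 'h"
  assumes "separable_hilbert_space smul ip"
    and "module.subspace smul W1" and "closed W1"
    and "module.subspace smul W2" and "closed W2"
    and "is_direct_sum W1 (orth_compl ip W2)"
    and "is_frame ip W2 \<Phi>"
  shows "(W1 \<noteq> {0} \<longrightarrow>
           closure (\<Union>\<Phi>od\<in>oblique_duals smul ip W1 W2 \<Phi>. range (analysis ip \<Phi>od)) = UNIV)
       \<and> (\<forall>G. is_frame ip W2 G \<and>
              oblique_duals smul ip W1 W2 \<Phi> \<subseteq> oblique_duals smul ip W1 W2 G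
            \<longrightarrow> \<Phi> = G)"
proof -
  interpret separable_hilbert_space smul ip by fact
  interpret oblique_frame smul ip W1 W2 \<Phi>
    by unfold_locales (use assms in auto)
  show ?thesis using closure_ranges frame_unique by blast
qed

end
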